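(* For all integers $n,r\ge 1$, $$|B_x(n,r)|\ \ge\ 1+\sum_{i=1}^{n}\binom{n}{i}\binom{i+2^r-2}{i}\Big/ r!.$$
   Context: Let $I$ (left vertices) and $O$ (right vertices) be disjoint finite sets with $|I|=n$ and $|O|=r$. An $(n,r)$-bipartite graph is $G=(I\oplus O,E)$ with edge set $E\subseteq I\times O$. The connected domain $I_c(G)$ is the set of vertices of $I$ with nonzero degree in $G$. Two $(n,r)$-bipartite graphs $G_1=(I\oplus O,E_1)$ and $G_2=(I\oplus O,E_2)$ are left-set-labeled equivalent if there exist bijections $\alpha:I\to I$ and $\beta:O\to O$ such that for all $x\in I,y\in O$, $(x,y)\in E_1$ iff $(\alpha(x),\beta(y))\in E_2$, and moreover $I_c(G_1)=I_c(G_2)$. $B_x(n,r)$ denotes the set of equivalence classes of $(n,r)$-bipartite graphs under left-set-labeled equivalence. *)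

theory Defs
  imports Complex_Main
begin

(* The vertex sets I (left) and R (right) are fixed throughout, so a bipartite graph on them is
   identified with its edge set. *)

definition bip_graphs :: "'a set \<Rightarrow> 'a set \<Rightarrow> ('a \<times> 'a) set set" where
  "bip_graphs I R = {E. E \<subseteq> I \<times> R}"

definition left_degree :: "'a set \<Rightarrow> ('a \<times> 'a) set \<Rightarrow> 'a \<Rightarrow> nat" where
  "left_degree R E x = card {y \<in> R. (x, y) \<in> E}"

definition connected_domain :: "'a set \<Rightarrow> 'a set \<Rightarrow> ('a \<times> 'a) set \<Rightarrow> 'a set" where
  "connected_domain I R E = {x \<in> I. left_degree R E x \<noteq> 0}"

definition left_set_labeled_equiv ::
    "'a set \<Rightarrow> 'a set \<Rightarrow> ('a \<times> 'a) set \<Rightarrow> ('a \<times> 'a) set \<Rightarrow> bool" where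
  "left_set_labeled_equiv I R E1 E2 \<longleftrightarrow>
     (\<exists>\<alpha> \<beta>. bij_betw \<alpha> I I \<and> bij_betw \<beta> R R \<and>
        (\<forall>x\<in>I. \<forall>y\<in>R. (x, y) \<in> E1 \<longleftrightarrow> (\<alpha> x, \<beta> y) \<in> E2)) \<and>
     connected_domain I R E1 = connected_domain I R E2"

definition left_set_labeled_rel :: "'a set \<Rightarrow> 'a set \<Rightarrow> (('a \<times> 'a) set \<times> ('a \<times> 'a) set) set" where
  "left_set_labeled_rel I R =
     {(E1, E2). E1 \<in> bip_graphs I R \<and> E2 \<in> bip_graphs I R \<and> left_set_labeled_equiv I R E1 E2}"

definition B_x :: "'a set \<Rightarrow> 'a set \<Rightarrow> ('a \<times> 'a) set set set" where
  "B_x I R = bip_graphs I R // left_set_labeled_rel I R"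

lemma left_set_labeled_equiv_refl: "left_set_labeled_equiv I R E E"
  unfolding left_set_labeled_equiv_def
  by (auto intro!: exI[of _ id])

lemma left_set_labeled_equiv_sym:
  assumes "left_set_labeled_equiv I R E1 E2"
  shows "left_set_labeled_equiv I R E2 E1"
proof -
  from assms obtain a b where a: "bij_betw a I I" and b: "bij_betw b R R"
    and e: "\<forall>x\<in>I. \<forall>y\<in>R. (x, y) \<in> E1 \<longleftrightarrow> (a x, b y) \<in> E2"
    and c: "connected_domain I R E1 = connected_domain I R E2"
    unfolding left_set_labeled_equiv_def by blast
  have "(x, y) \<in> E2 \<longleftrightarrow> (inv_into I a x, inv_into R b y) \<in> E1" if "x \<in> I" "y \<in> R" for x y
    using e that bij_betw_inv_into_right[OF a] bij_betw_inv_into_right[OF b]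
      bij_betwE[OF bij_betw_inv_into[OF a]] bij_betwE[OF bij_betw_inv_into[OF b]] by simp
  then show ?thesis
    unfolding left_set_labeled_equiv_def
    using bij_betw_inv_into[OF a] bij_betw_inv_into[OF b] c by metis
qed

lemma left_set_labeled_equiv_trans:
  assumes "left_set_labeled_equiv I R E1 E2" "left_set_labeled_equiv I R E2 E3"
  shows "left_set_labeled_equiv I R E1 E3"
proof -
  from assms(1) obtain a b where a: "bij_betw a I I" and b: "bij_betw b R R"
    and e: "\<forall>x\<in>I. \<forall>y\<in>R. (x, y) \<in> E1 \<longleftrightarrow> (a x, b y) \<in> E2"
    and c: "connected_domain I R E1 = connected_domain I R E2"
    unfolding left_set_labeled_equiv_def by blast
  from assms(2) obtain a' b' where a': "bij_betw a' I I" and b': "bij_betw b' R R"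
    and e': "\<forall>x\<in>I. \<forall>y\<in>R. (x, y) \<in> E2 \<longleftrightarrow> (a' x, b' y) \<in> E3"
    and c': "connected_domain I R E2 = connected_domain I R E3"
    unfolding left_set_labeled_equiv_def by blast
  have "\<forall>x\<in>I. \<forall>y\<in>R. (x, y) \<in> E1 \<longleftrightarrow> ((a' \<circ> a) x, (b' \<circ> b) y) \<in> E3"
    using e e' bij_betwE[OF a] bij_betwE[OF b] by simp
  then show ?thesis
    unfolding left_set_labeled_equiv_def
    using bij_betw_trans[OF a a'] bij_betw_trans[OF b b'] c c' by blast
qed

lemma equiv_left_set_labeled_rel: "equiv (bip_graphs I R) (left_set_labeled_rel I R)"
  by (rule equivI)
    (auto simp: refl_on_def sym_def trans_def left_set_labeled_rel_def
      intro: left_set_labeled_equiv_refl left_set_labeled_equiv_sym left_set_labeled_equiv_trans)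

end

theory Submission
  imports Defs "HOL-Library.Multiset" "HOL-Combinatorics.Permutations"
begin

text \<open>
  Assign to a graph its connected domain together with the multiset of neighbourhoods of the
  vertices of that domain. The nonempty graphs realise every pair of a nonempty \<open>S \<subseteq> I\<close>
  and a multiset of \<open>card S\<close> nonempty subsets of \<open>R\<close>, and these pairs are counted by the sum.
  An equivalence of graphs fixes \<open>S\<close> and moves the multiset by a permutation of \<open>R\<close>, so each class
  accounts for at most \<open>r!\<close> pairs. The empty graph is a class of its own and gives the summand 1.
\<close>

definition profile :: "('a \<times> 'b) set \<Rightarrow> 'a set \<times> 'b set multiset" where
  "profile E = (Domain E, image_mset (\<lambda>x. E `` {x}) (mset_set (Domain E)))"

definition profiles :: "'a set \<Rightarrow> 'b set \<Rightarrow> ('a set \<times> 'b set multiset) set" where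
  "profiles I R = (SIGMA S:Pow I - {{}}. multisets_of_size (Pow R - {{}}) (card S))"

text \<open>Degrees are values of \<open>card\<close>, which is 0 on infinite sets as well; with
  \<open>R\<close> finite, degree 0 means exactly that there are no neighbours.\<close>

lemma connected_domain_eq_Domain:
  assumes "finite R" "E \<in> bip_graphs I R"
  shows "connected_domain I R E = Domain E"
  using assms by (auto simp: connected_domain_def left_degree_def bip_graphs_def)

text \<open>Turns a multiset into a choice of one neighbourhood per vertex. Any distribution will
  do, so the induction hands an arbitrary element of \<open>M\<close> to the new vertex.\<close>

lemma ex_image_mset_set_eq:
  assumes "finite S" "size M = card S"
  shows "\<exists>f. image_mset f (mset_set S) = M"
  using assms
proof (induction S arbitrary: M rule: finite_induct)
  case (insert x S)
  then obtain a N where M: "M = add_mset a N" "size N = card S"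
    by (metis card_insert_disjoint size_eq_Suc_imp_eq_union size_add_mset nat.inject add_mset_add_single)
  then obtain f where f: "image_mset f (mset_set S) = N"
    using insert.IH by blast
  have "image_mset (f(x := a)) (mset_set S) = image_mset f (mset_set S)"
    using insert.hyps by (intro image_mset_cong) auto
  then have "image_mset (f(x := a)) (mset_set (insert x S)) = M"
    using insert.hyps f M by simp
  then show ?case by blast
qed simp

lemma ex_profile_eq:
  assumes "finite I" "p \<in> profiles I R"
  obtains E where "E \<in> bip_graphs I R" "E \<noteq> {}" "profile E = p"
proof -
  obtain S M where p: "p = (S, M)" and S: "S \<subseteq> I" "S \<noteq> {}"
    and M: "set_mset M \<subseteq> Pow R - {{}}" "size M = card S"
    using assms(2) by (auto simp: profiles_def multisets_of_size_def)
  have fin: "finite S"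
    using S assms(1) finite_subset by blast
  obtain f where f: "image_mset f (mset_set S) = M"
    using ex_image_mset_set_eq[OF fin M(2)] by blast
  then have f_sub: "f x \<subseteq> R \<and> f x \<noteq> {}" if "x \<in> S" for x
    using that M(1) fin by (force simp flip: f)
  \<comment> \<open>Joining \<open>x\<close> to all of \<open>f x\<close> makes \<open>f x\<close>
    its neighbourhood. As every \<open>f x\<close> is nonempty, no vertex of \<open>S\<close> drops
    out of the domain.\<close>
  define E where "E = (SIGMA x:S. f x)"
  have dom: "Domain E = S"
    using f_sub by (auto simp: E_def)
  have "image_mset (\<lambda>x. E `` {x}) (mset_set S) = image_mset f (mset_set S)"
    using fin by (intro image_mset_cong) (auto simp: E_def)
  then have "profile E = p"
    using dom f p by (simp add: profile_def)
  moreover have "E \<in> bip_graphs I R" "E \<noteq> {}"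
    using f_sub S dom by (auto simp: bip_graphs_def E_def)
  ultimately show ?thesis
    using that by blast
qed

lemma card_profiles:
  assumes "finite I" "finite R"
  shows "card (profiles I R) =
    (\<Sum>i = 1..card I. (card I choose i) * ((i + 2 ^ card R - 2) choose i))"
proof -
  let ?g = "\<lambda>i. (i + 2 ^ card R - 2) choose i"
  have "card (Pow R - {{}}) = 2 ^ card R - 1"
    using assms(2) by (simp add: card_Diff_subset card_Pow)
  \<comment> \<open>Stars and bars over the nonempty subsets of \<open>R\<close>: the
    \<open>- 1\<close> of that formula and the excluded empty subset together give the
    \<open>- 2\<close>.\<close>
  then have "card (multisets_of_size (Pow R - {{}}) i) = ?g i" for i
    using assms(2) by (simp add: card_multisets_of_size add.commute[of i] numeral_2_eq_2)
  then have "card (profiles I R) = (\<Sum>S\<in>Pow I - {{}}. ?g (card S))"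
    using assms unfolding profiles_def by (subst card_SigmaI) auto
  \<comment> \<open>Grouping by cardinality; only the excluded empty set has size 0, so the index
    starts at 1.\<close>
  also have "\<dots> = (\<Sum>i = 1..card I. \<Sum>S | S \<in> Pow I - {{}} \<and> card S = i. ?g (card S))"
  proof (rule sum.group[symmetric])
    show "card ` (Pow I - {{}}) \<subseteq> {1..card I}"
      using assms(1) by (auto simp: card_mono Suc_le_eq card_gt_0_iff dest: finite_subset)
  qed (use assms(1) in auto)
  also have "\<dots> = (\<Sum>i = 1..card I. (card I choose i) * ?g i)"
  proof (rule sum.cong[OF refl])
    fix i assume "i \<in> {1..card I}"
    then have "{S. S \<in> Pow I - {{}} \<and> card S = i} = {S. S \<subseteq> I \<and> card S = i}"
      by auto
    then show "(\<Sum>S | S \<in> Pow I - {{}} \<and> card S = i. ?g (card S)) = (card I choose i) * ?g i"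
      using n_subsets[OF assms(1), of i] by simp
  qed
  finally show ?thesis .
qed

text \<open>The left bijection maps the common domain onto itself, so it merely reorders the
  neighbourhoods, which a multiset does not record. What remains is the action of the right
  bijection on subsets of \<open>R\<close>.\<close>

lemma profile_equiv:
  assumes "finite R" and E1: "E1 \<in> bip_graphs I R" and E2: "E2 \<in> bip_graphs I R"
    and "left_set_labeled_equiv I R E1 E2"
  obtains p where "p permutes R"
    "profile E2 = (Domain E1, image_mset (image p) (snd (profile E1)))"
proof -
  obtain a b where a: "bij_betw a I I" and b: "bij_betw b R R"
    and ab: "\<And>x y. x \<in> I \<Longrightarrow> y \<in> R \<Longrightarrow> (x, y) \<in> E1 \<longleftrightarrow> (a x, b y) \<in> E2"
    and "connected_domain I R E1 = connected_domain I R E2"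
    using assms(4) unfolding left_set_labeled_equiv_def by blast
  then have dom: "Domain E1 = Domain E2"
    using connected_domain_eq_Domain assms by metis
  have sub: "E1 \<subseteq> I \<times> R" "E2 \<subseteq> I \<times> R"
    using E1 E2 by (auto simp: bip_graphs_def)
  \<comment> \<open>\<open>permutes\<close> asks for a function that fixes every point outside
    \<open>R\<close>, so \<open>b\<close> is extended by the identity.\<close>
  define p where "p y = (if y \<in> R then b y else y)" for y
  have "bij_betw p R R"
    using b by (simp add: p_def cong: bij_betw_cong)
  then have p: "p permutes R"
    by (rule bij_imp_permutes) (simp add: p_def)
  have nbh: "E2 `` {a x} = p ` (E1 `` {x})" if "x \<in> I" for x
  proof (intro equalityI subsetI)
    fix z assume z: "z \<in> E2 `` {a x}"
    then have "z \<in> b ` R"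
      using sub b by (auto simp: bij_betw_def)
    then obtain y where "y \<in> R" "z = b y"
      by blast
    then show "z \<in> p ` (E1 `` {x})"
      using z ab[OF that] by (auto simp: p_def)
  next
    fix z assume "z \<in> p ` (E1 `` {x})"
    then show "z \<in> E2 `` {a x}"
      using sub ab[OF that] by (auto simp: p_def)
  qed
  have "a ` Domain E1 = Domain E2"
  proof (intro equalityI subsetI)
    fix z assume "z \<in> a ` Domain E1"
    then show "z \<in> Domain E2"
      using sub ab by blast
  next
    fix z assume z: "z \<in> Domain E2"
    then have "z \<in> a ` I"
      using sub a by (auto simp: bij_betw_def)
    then obtain x where x: "x \<in> I" "z = a x"
      by blast
    then have "E1 `` {x} \<noteq> {}"
      using z nbh[of x] by auto
    then show "z \<in> a ` Domain E1"
      using x by auto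
  qed
  moreover have inj: "inj_on a (Domain E1)"
    using a sub by (auto simp: bij_betw_def intro: inj_on_subset)
  ultimately have "mset_set (Domain E2) = image_mset a (mset_set (Domain E1))"
    by (simp add: image_mset_mset_set)
  then have "snd (profile E2) = image_mset (\<lambda>x. E2 `` {a x}) (mset_set (Domain E1))"
    by (simp add: profile_def multiset.map_comp comp_def)
  also have "\<dots> = image_mset (\<lambda>x. p ` (E1 `` {x})) (mset_set (Domain E1))"
  proof (rule image_mset_cong)
    fix x assume "x \<in># mset_set (Domain E1)"
    \<comment> \<open>\<open>I\<close> may be infinite here; \<open>mset_set\<close> of an infinite
      set is empty, so membership still yields an element of the domain.\<close>
    then have "x \<in> Domain E1"
      by (metis mset_set.infinite elem_mset_set empty_iff set_mset_empty)
    then show "E2 `` {a x} = p ` (E1 `` {x})"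
      using sub by (intro nbh) auto
  qed
  finally have "profile E2 = (Domain E1, image_mset (image p) (snd (profile E1)))"
    using dom by (simp add: profile_def multiset.map_comp comp_def)
  with p show ?thesis by (rule that)
qed

text \<open>Once a representative is fixed, each profile in the class comes from a permutation of
  \<open>R\<close>. Distinct permutations may give the same profile, hence only an
  inequality.\<close>

lemma card_profile_class_le:
  assumes "finite R" "C \<in> B_x I R"
  shows "card (profile ` C) \<le> fact (card R)"
proof -
  obtain E where E: "E \<in> bip_graphs I R" and C: "C = left_set_labeled_rel I R `` {E}"
    using assms(2) unfolding B_x_def by (rule quotientE)
  let ?P = "{p. p permutes R}"
  let ?h = "\<lambda>p. (Domain E, image_mset (image p) (snd (profile E)))"
  have fin: "finite ?P"
    using assms(1) by (rule finite_permutations)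
  have "profile ` C \<subseteq> ?h ` ?P"
  proof
    fix q assume "q \<in> profile ` C"
    then obtain E' where "E' \<in> bip_graphs I R" "left_set_labeled_equiv I R E E'" "q = profile E'"
      using C by (auto simp: left_set_labeled_rel_def)
    then show "q \<in> ?h ` ?P"
      using profile_equiv[OF assms(1) E] by (metis (mono_tags, lifting) imageI mem_Collect_eq)
  qed
  then have "card (profile ` C) \<le> card (?h ` ?P)"
    using fin by (intro card_mono) auto
  also have "\<dots> \<le> card ?P"
    using fin by (rule card_image_le)
  also have "\<dots> = fact (card R)"
    using assms(1) by (intro card_permutations) auto
  finally show ?thesis .
qed

text \<open>Equivalent graphs share their connected domain, and only the empty graph has an empty
  one.\<close>

lemma empty_graph_class:
  assumes "finite R"
  shows "{{}} \<in> B_x I R"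
proof -
  have "{} \<in> bip_graphs I R"
    by (simp add: bip_graphs_def)
  moreover have "E = {}" if "E \<in> bip_graphs I R" "left_set_labeled_equiv I R {} E" for E
  proof -
    have "connected_domain I R {} = connected_domain I R E"
      using that(2) by (simp add: left_set_labeled_equiv_def)
    then show ?thesis
      using connected_domain_eq_Domain[OF assms] that(1) calculation by (metis Domain_empty_iff)
  qed
  ultimately have "left_set_labeled_rel I R `` {{}} = {{}}"
    using left_set_labeled_equiv_refl by (auto simp: left_set_labeled_rel_def)
  then show ?thesis
    using quotientI[OF \<open>{} \<in> bip_graphs I R\<close>] unfolding B_x_def by metis
qed

theorem theorem2:
  fixes I R :: "'a set" and n r :: nat
  assumes "finite I" and "finite R" and "I \<inter> R = {}"
    and "card I = n" and "card R = r"
    and "n \<ge> 1" and "r \<ge> 1"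
  shows "real (card (B_x I R)) \<ge>
    1 + (\<Sum>i = 1..n. real (n choose i) * real ((i + 2 ^ r - 2) choose i)) / fact r"
proof -
  \<comment> \<open>The class of the empty graph is set aside for the summand 1; the remaining
    classes already cover all of \<open>profiles I R\<close>.\<close>
  let ?B = "B_x I R - {{{}}}"
  have "finite (bip_graphs I R)"
    using assms by (simp add: bip_graphs_def Pow_def[symmetric])
  then have fin: "finite (B_x I R)"
    unfolding B_x_def using equiv_left_set_labeled_rel
    by (intro finite_quotient) (auto simp: left_set_labeled_rel_def)
  have fin_class: "finite C" if "C \<in> B_x I R" for C
    using that \<open>finite (bip_graphs I R)\<close> equiv_left_set_labeled_rel[of I R]
    by (metis B_x_def Union_quotient Union_upper finite_subset)
  have "profiles I R \<subseteq> (\<Union>C\<in>?B. profile ` C)"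
  proof
    fix p assume "p \<in> profiles I R"
    then obtain E where E: "E \<in> bip_graphs I R" "E \<noteq> {}" "profile E = p"
      by (rule ex_profile_eq[OF assms(1)])
    then obtain C where "C \<in> B_x I R" "E \<in> C"
      using Union_quotient[OF equiv_left_set_labeled_rel[of I R]] unfolding B_x_def by blast
    \<comment> \<open>\<open>C\<close> contains the nonempty graph \<open>E\<close>, so it is not
      the class set aside.\<close>
    with E show "p \<in> (\<Union>C\<in>?B. profile ` C)"
      by auto
  qed
  then have "card (profiles I R) \<le> card (\<Union>C\<in>?B. profile ` C)"
    using fin fin_class by (intro card_mono) auto
  also have "\<dots> \<le> (\<Sum>C\<in>?B. card (profile ` C))"
    using fin by (intro card_UN_le) auto
  also have "\<dots> \<le> (\<Sum>C\<in>?B. fact r)"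
    using card_profile_class_le[OF assms(2)] assms(5) by (intro sum_mono) auto
  also have "\<dots> = (card (B_x I R) - 1) * fact r"
    using fin empty_graph_class[OF assms(2)] by simp
  finally have "real (card (profiles I R)) \<le> real ((card (B_x I R) - 1) * fact r)"
    by (rule of_nat_mono)
  \<comment> \<open>The subtraction above is one of naturals; this bound carries it over to the
    reals without truncation.\<close>
  moreover have "card (B_x I R) \<ge> 1"
    using fin empty_graph_class[OF assms(2), of I] by (auto simp: Suc_le_eq card_gt_0_iff)
  ultimately have "real (card (profiles I R)) \<le> (real (card (B_x I R)) - 1) * fact r"
    by (simp add: of_nat_diff)
  then have "real (card (profiles I R)) / fact r \<le> real (card (B_x I R)) - 1"
    by (simp add: divide_le_eq)
  then show ?thesis
    using card_profiles[OF assms(1,2)] assms(4,5) by simp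
qed

end
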